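(* Let $n\ge 1$, let $n_0,n_1\ge 0$ with $n_0+n_1=n$, and let $C$ be a color map on the triangular lattice of size $n$ such that each of the three boundary sides carries exactly $n_0$ edges of color $0$ and $n_1$ edges of color $1$. Let $m(C)$ and $s(C)$ be the numbers of edges of $C$ of color $m$ and of color $3$ respectively. Then $$m(C)=G(C,0)+G(C,1)+G(C,2)-n_0n_1$$ and $$s(C)=2n_0n_1-G(C,0)-G(C,1)-G(C,2).$$
   Context: Let $\xi=e^{i\pi/3}$ and $T_n=\{r+s\xi:\ r,s\in\mathbb{Z}_{\ge0},\ r+s\le n\}\subset\mathbb{C}$. The edges of the lattice are the segments $[z,z+w]$ with $z,z+w\in T_n$ and $w\in\{1,\xi,\bar\xi\}$; the faces are the unit triangles with vertices in $T_n$. A color map is a map $C$ from the set of edges to $\{0,1,3,m\}$ such that, for every triangular face, the colors of its three edges read in clockwise order form, up to cyclic rotation, one of the triples $(0,0,0)$, $(1,1,1)$, $(1,0,3)$, $(0,1,m)$. Boundary sides: bottom edges $B_k=[k-1,k]$, right edges $R_k=[(k-1)+(n-k+1)\xi,\ k+(n-k)\xi]$, left edges $L_k=[(k-1)\xi,k\xi]$, for $1\le k\le n$. Gash numbers: $G(C,0)=\sum_{k:\,C(B_k)=0}\#\{k'>k: C(B_{k'})=1\}$ (number of $1$-colored bottom edges east of each $0$-colored bottom edge), $G(C,1)=\sum_{k:\,C(R_k)=0}\#\{k'<k: C(R_{k'})=1\}$ (number of $1$-colored right edges north of each $0$-colored right edge), $G(C,2)=\sum_{k:\,C(L_k)=0}\#\{k'<k: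 C(L_{k'})=1\}$ (number of $1$-colored left edges south of each $0$-colored left edge). *)

theory Defs
  imports "HOL-Analysis.Analysis"
begin

definition xi :: complex where
  "xi = exp (\<i> * of_real pi / 3)"

definition lattice_points :: "nat \<Rightarrow> complex set" where
  "lattice_points n = {of_nat r + of_nat s * xi | r s :: nat. r + s \<le> n}"

definition lattice_edges :: "nat \<Rightarrow> complex set set" where
  "lattice_edges n =
    {closed_segment z (z + w) | z w.
       z \<in> lattice_points n \<and> z + w \<in> lattice_points n \<and> w \<in> {1, xi, cnj xi}}"

(* The vertices a, b, c of a unit triangular face, listed in clockwise order: the last
   conjunct says that the signed area of (a, b, c) is negative. Every face occurs once for
   each choice of its first vertex a. *)
definition clockwise_face :: "nat \<Rightarrow> complex \<Rightarrow> complex \<Rightarrow> complex \<Rightarrow> bool" where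
  "clockwise_face n a b c \<longleftrightarrow>
     {a, b, c} \<subseteq> lattice_points n \<and>
     dist a b = 1 \<and> dist b c = 1 \<and> dist c a = 1 \<and>
     Im ((c - a) * cnj (b - a)) < 0"

datatype color = Col0 | Col1 | Col3 | ColM

(* A coloring is a total function on sets of complex numbers; only its values on
   lattice_edges n are constrained or used. *)
definition color_map :: "nat \<Rightarrow> (complex set \<Rightarrow> color) \<Rightarrow> bool" where
  "color_map n C \<longleftrightarrow>
     (\<forall>a b c. clockwise_face n a b c \<longrightarrow>
        (\<exists>j. rotate j [C (closed_segment a b), C (closed_segment b c), C (closed_segment c a)] \<in>
             {[Col0, Col0, Col0], [Col1, Col1, Col1], [Col1, Col0, Col3], [Col0, Col1, ColM]}))"

(* The k-th edge (1 \<le> k \<le> n) of each side. The bottom side is numbered from west to east,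
   the right side from north to south, the left side from south to north. *)
definition bottom_edge :: "nat \<Rightarrow> complex set" where
  "bottom_edge k = closed_segment (of_nat k - 1) (of_nat k)"

definition right_edge :: "nat \<Rightarrow> nat \<Rightarrow> complex set" where
  "right_edge n k =
     closed_segment ((of_nat k - 1) + (of_nat n - of_nat k + 1) * xi)
                    (of_nat k + (of_nat n - of_nat k) * xi)"

definition left_edge :: "nat \<Rightarrow> complex set" where
  "left_edge k = closed_segment ((of_nat k - 1) * xi) (of_nat k * xi)"

definition gash0 :: "nat \<Rightarrow> (complex set \<Rightarrow> color) \<Rightarrow> nat" where
  "gash0 n C =
     (\<Sum>k\<in>{k\<in>{1..n}. C (bottom_edge k) = Col0}.
        card {k'\<in>{1..n}. k' > k \<and> C (bottom_edge k') = Col1})"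

definition gash1 :: "nat \<Rightarrow> (complex set \<Rightarrow> color) \<Rightarrow> nat" where
  "gash1 n C =
     (\<Sum>k\<in>{k\<in>{1..n}. C (right_edge n k) = Col0}.
        card {k'\<in>{1..n}. k' < k \<and> C (right_edge n k') = Col1})"

definition gash2 :: "nat \<Rightarrow> (complex set \<Rightarrow> color) \<Rightarrow> nat" where
  "gash2 n C =
     (\<Sum>k\<in>{k\<in>{1..n}. C (left_edge k) = Col0}.
        card {k'\<in>{1..n}. k' < k \<and> C (left_edge k') = Col1})"

definition side_count :: "nat \<Rightarrow> (complex set \<Rightarrow> color) \<Rightarrow> (nat \<Rightarrow> complex set) \<Rightarrow> color \<Rightarrow> nat" where
  "side_count n C e x = card {k\<in>{1..n}. C (e k) = x}"

definition color_count :: "nat \<Rightarrow> (complex set \<Rightarrow> color) \<Rightarrow> color \<Rightarrow> nat" where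
  "color_count n C x = card {e \<in> lattice_edges n. C e = x}"

lemma finite_lattice_points: "finite (lattice_points n)"
proof (rule finite_subset)
  show "lattice_points n \<subseteq> (\<lambda>(r, s). of_nat r + of_nat s * xi) ` ({..n} \<times> {..n})"
    unfolding lattice_points_def by force
qed auto

lemma finite_lattice_edges: "finite (lattice_edges n)"
proof (rule finite_subset)
  show "lattice_edges n \<subseteq> (\<lambda>(z, w). closed_segment z (z + w)) ` (lattice_points n \<times> {1, xi, cnj xi})"
    unfolding lattice_edges_def by auto
qed (simp add: finite_lattice_points)

end

theory Submission
  imports Defs
begin

text \<open>Deform the lattice by scaling every edge of color 0 by a constant \<open>\<alpha>\<close> and every edge of
  color 1 by a constant \<open>\<beta>\<close>. The scaling factors of the colors 3 and m are then forced by the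
  requirement that every face still closes up, and they depend on the color only, so the vertices
  move to \<open>\<alpha> P + \<beta> Q\<close> for two vertex functions \<open>P\<close>, \<open>Q\<close>. The part of the oriented area bilinear in
  \<open>\<alpha>\<close>, \<open>\<beta>\<close> vanishes on faces with colors 000 and 111, and takes one constant value on the faces
  with an edge of color 3 and another on those with an edge of color m. By Green's formula its
  total is a boundary sum, which the gash numbers and \<open>n\<^sub>0 n\<^sub>1\<close> determine. The imaginary part of
  this identity gives \<open>s + m = n\<^sub>0 n\<^sub>1\<close>, the real part gives
  \<open>s - m = 3 n\<^sub>0 n\<^sub>1 - 2 (G\<^sub>0 + G\<^sub>1 + G\<^sub>2)\<close>.\<close>

section \<open>Arithmetic of the sixth root of unity \<open>xi\<close>\<close>

lemma xi_eq: "xi = Complex (1/2) (sqrt 3 / 2)"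
proof -
  have "xi = cis (pi / 3)"
    by (simp add: xi_def cis_conv_exp)
  then show ?thesis
    by (simp add: complex_eq_iff cos_60 sin_60)
qed

lemma Re_xi [simp]: "Re xi = 1/2" and Im_xi [simp]: "Im xi = sqrt 3 / 2"
  by (simp_all add: xi_eq)

lemma cnj_xi: "cnj xi = 1 - xi"
  by (simp add: complex_eq_iff)

lemma norm_xi [simp]: "norm xi = 1"
  by (simp add: xi_def)

lemma xi_mult_xi: "xi * xi = xi - 1"
  by (simp add: complex_eq_iff field_simps)

lemma xi_mult_xi_mult: "xi * (xi * z) = xi * z - z"
  by (simp add: xi_mult_xi left_diff_distrib flip: mult.assoc)

section \<open>Sums over a triangle and a discrete Green formula\<close>

text \<open>The pairs with \<open>r + s < n\<close> index the upward faces of the lattice of size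
  \<open>n\<close>; those with \<open>r + s < n - 1\<close> index the downward ones.\<close>

definition triangle_sum :: "nat \<Rightarrow> (nat \<Rightarrow> nat \<Rightarrow> 'a) \<Rightarrow> 'a::comm_monoid_add" where
  "triangle_sum n f = (\<Sum>s<n. \<Sum>r<n - s. f r s)"

lemma triangle_sum_add:
  "triangle_sum n (\<lambda>r s. f r s + g r s) = triangle_sum n f + triangle_sum n g"
  by (simp add: triangle_sum_def sum.distrib)

lemma triangle_sum_cong:
  assumes "\<And>r s. r + s < n \<Longrightarrow> f r s = g r s"
  shows "triangle_sum n f = triangle_sum n g"
  unfolding triangle_sum_def using assms by (intro sum.cong refl) auto

lemma triangle_sum_eq: "triangle_sum n f = (\<Sum>(r, s)\<in>{(r, s). r + s < n}. f r s)"
proof -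
  have "triangle_sum n f = (\<Sum>(s, r)\<in>Sigma {..<n} (\<lambda>s. {..<n - s}). f r s)"
    by (simp add: triangle_sum_def sum.Sigma)
  also have "\<dots> = (\<Sum>(r, s)\<in>{(r, s). r + s < n}. f r s)"
    by (rule sum.reindex_bij_witness[of _ prod.swap prod.swap]) auto
  finally show ?thesis .
qed

text \<open>This lemma and the next two peel off the indices along one side; each serves one of the
  three edge directions in Green's formula.\<close>

lemma triangle_sum_left:
  "triangle_sum (Suc n) f = triangle_sum n (\<lambda>r. f (Suc r)) + (\<Sum>s<Suc n. f 0 s)"
proof -
  have "triangle_sum (Suc n) f = (\<Sum>s<Suc n. (\<Sum>r<n - s. f (Suc r) s) + f 0 s)"
    unfolding triangle_sum_def
    by (intro sum.cong refl)
      (simp add: Suc_diff_le sum.lessThan_Suc_shift add.commute del: sum.lessThan_Suc)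
  then show ?thesis
    by (simp add: sum.distrib triangle_sum_def add.assoc)
qed

lemma triangle_sum_bottom:
  "triangle_sum (Suc n) f = triangle_sum n (\<lambda>r s. f r (Suc s)) + (\<Sum>r<Suc n. f r 0)"
  unfolding triangle_sum_def by (subst sum.lessThan_Suc_shift) (simp add: add.commute)

lemma triangle_sum_right:
  "triangle_sum (Suc n) f = triangle_sum n f + (\<Sum>r<Suc n. f r (n - r))"
proof -
  have "triangle_sum (Suc n) f = (\<Sum>s<Suc n. (\<Sum>r<n - s. f r s) + f (n - s) s)"
    unfolding triangle_sum_def by (intro sum.cong refl) (simp add: Suc_diff_le)
  also have "\<dots> = triangle_sum n f + (\<Sum>s<Suc n. f (n - s) s)"
    by (simp add: sum.distrib triangle_sum_def add.assoc)
  also have "(\<Sum>s<Suc n. f (n - s) s) = (\<Sum>r<Suc n. f r (n - r))"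
    by (rule sum.reindex_bij_witness[of _ "\<lambda>r. n - r" "\<lambda>r. n - r"]) auto
  finally show ?thesis .
qed

text \<open>Every edge lies in exactly one upward triangle (indexed by its lower left corner), and in
  exactly one downward triangle unless it is on the boundary.\<close>

lemma triangle_green:
  assumes "n > 0"
  shows "triangle_sum n (\<lambda>r s. l r s + d r s + h r s) =
    triangle_sum (n - 1) (\<lambda>r s. l (Suc r) s + d r s + h r (Suc s)) +
    ((\<Sum>s<n. l 0 s) + (\<Sum>r<n. d r (n - 1 - r)) + (\<Sum>r<n. h r 0))"
proof -
  obtain m where n: "n = Suc m"
    using assms gr0_implies_Suc by blast
  show ?thesis
    unfolding n triangle_sum_add triangle_sum_left[of m l] triangle_sum_right[of m d]
      triangle_sum_bottom[of m h]
    by (simp add: ac_simps del: sum.lessThan_Suc)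
qed

section \<open>Admissible faces, weights and the area form\<close>

definition face_colors :: "color \<Rightarrow> color \<Rightarrow> color \<Rightarrow> bool" where
  "face_colors x y z \<longleftrightarrow>
    (x, y, z) \<in> {(Col0, Col0, Col0), (Col1, Col1, Col1),
      (Col1, Col0, Col3), (Col0, Col3, Col1), (Col3, Col1, Col0),
      (Col0, Col1, ColM), (Col1, ColM, Col0), (ColM, Col0, Col1)}"

lemma face_colors_if_rotate:
  assumes "rotate j [x, y, z] \<in>
    {[Col0, Col0, Col0], [Col1, Col1, Col1], [Col1, Col0, Col3], [Col0, Col1, ColM]}"
  shows "face_colors x y z"
proof -
  define i where "i = j mod 3"
  have "i = 0 \<or> i = Suc 0 \<or> i = Suc (Suc 0)"
    unfolding i_def by auto
  then have "rotate i [x, y, z] \<in> {[x, y, z], [y, z, x], [z, x, y]}"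
    by auto
  moreover have "rotate i [x, y, z] = rotate j [x, y, z]"
    by (subst (2) rotate_conv_mod) (simp add: i_def)
  ultimately have "{[x, y, z], [y, z, x], [z, x, y]} \<inter>
      {[Col0, Col0, Col0], [Col1, Col1, Col1], [Col1, Col0, Col3], [Col0, Col1, ColM]} \<noteq> {}"
    using assms by (metis IntI empty_iff)
  then show ?thesis
    by (auto simp: face_colors_def)
qed

text \<open>An edge of color \<open>c\<close> and direction \<open>u\<close> is deformed to
  \<open>u\<close> times \<alpha> \<open>weight0 c\<close> + \<beta> \<open>weight1 c\<close>.
  Putting the triples (1,0,3) and (0,1,m) into the closing condition of
  \<open>weight0_closed\<close> and \<open>weight1_closed\<close> yields the values at
  \<open>Col3\<close> and \<open>ColM\<close>.\<close>

fun weight0 :: "color \<Rightarrow> complex" where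
  "weight0 Col0 = 1" | "weight0 Col1 = 0" | "weight0 Col3 = cnj xi" | "weight0 ColM = xi"

fun weight1 :: "color \<Rightarrow> complex" where
  "weight1 Col0 = 0" | "weight1 Col1 = 1" | "weight1 Col3 = xi" | "weight1 ColM = cnj xi"

text \<open>A face has at most one edge of color 3 or m, so its whole area can be charged to that
  edge.\<close>

fun area :: "color \<Rightarrow> complex" where
  "area Col3 = - xi\<^sup>2" | "area ColM = (cnj xi)\<^sup>2" | "area _ = 0"

text \<open>On a walk around a face the three edges point along \<open>xi\<close>,
  \<open>cnj xi\<close> and -1, and the deformed steps must add up to zero.\<close>

lemma weight0_closed: "face_colors x y z \<Longrightarrow> xi * weight0 x + cnj xi * weight0 y = weight0 z"
  and weight1_closed: "face_colors x y z \<Longrightarrow> xi * weight1 x + cnj xi * weight1 y = weight1 z"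
  by (auto simp: face_colors_def cnj_xi algebra_simps xi_mult_xi)

text \<open>The arguments are the values \<open>(P, Q)\<close> at the two ends of an edge. Using the sum
  \<open>P u + P v\<close> makes the flux antisymmetric under reversal of the edge, so that interior edges
  cancel.\<close>

definition flux :: "complex \<times> complex \<Rightarrow> complex \<times> complex \<Rightarrow> complex" where
  "flux u v = cnj (fst u + fst v) * (snd v - snd u)"

text \<open>Shoelace identity: translations of \<open>P\<close> and \<open>Q\<close> cancel around a
  closed path.\<close>

lemma flux_triangle:
  "flux (a, a') (b, b') + flux (b, b') (c, c') + flux (c, c') (a, a') =
     cnj (b - a) * (c' - b') - cnj (c - b) * (b' - a')"
  by (simp add: flux_def algebra_simps)

text \<open>The first expression is \<open>flux_triangle\<close> on an upward face, the second its
  negative on a downward face; the closing condition turns one into the other. The conjugation in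
  the form makes it invariant under a common rotation of \<open>P\<close> and \<open>Q\<close>, so
  cyclic rotations of a triple have equal area.\<close>

lemma area_face:
  assumes "face_colors x y z"
  shows "cnj (xi * weight0 x) * (cnj xi * weight1 y) - cnj (cnj xi * weight0 y) * (xi * weight1 x) =
      area x + area y + area z"
    and "cnj (xi * weight0 x) * weight1 z - cnj (weight0 z) * (xi * weight1 x) =
      area x + area y + area z"
  using assms
  by (auto simp: face_colors_def cnj_xi algebra_simps xi_mult_xi xi_mult_xi_mult power2_eq_square)

section \<open>Pairs of colors along a side, and the flux of a side\<close>

text \<open>Pairs are grouped by their later member, so that appending an edge to a side adds a
  single term.\<close>

definition color_pairs :: "color \<Rightarrow> color \<Rightarrow> (nat \<Rightarrow> color) \<Rightarrow> nat \<Rightarrow> nat" where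
  "color_pairs x y f n = (\<Sum>k<n. of_bool (f k = y) * (\<Sum>j<k. of_bool (f j = x)))"

text \<open>An \<open>x\<close>-position and a \<open>y\<close>-position are distinct, so each such
  pair is counted by exactly one of the two terms.\<close>

lemma color_pairs_swap:
  assumes "x \<noteq> y"
  shows "color_pairs x y f n + color_pairs y x f n =
    (\<Sum>k<n. of_bool (f k = x)) * (\<Sum>k<n. of_bool (f k = y))"
  using assms by (induction n) (auto simp: color_pairs_def algebra_simps)

lemma card_filter_eq_sum: "finite A \<Longrightarrow> card {x\<in>A. P x} = (\<Sum>x\<in>A. of_bool (P x))"
  by (simp add: Int_def)

lemma sum_card_filter_eq:
  assumes "finite A"
  shows "(\<Sum>k\<in>{k\<in>A. P k}. card {j\<in>A. Q k j}) = (\<Sum>k\<in>A. of_bool (P k) * (\<Sum>j\<in>A. of_bool (Q k j)))"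
  unfolding card_filter_eq_sum[OF assms] sum.inter_filter[OF assms]
  by (intro sum.cong refl) simp

text \<open>The left side groups pairs by their earlier member, so the sums are exchanged. Sides are
  numbered from 1, hence \<open>g (Suc k)\<close>.\<close>

lemma color_pairs_eq_card_greater:
  "(\<Sum>k\<in>{k\<in>{1..n}. g k = x}. card {k'\<in>{1..n}. k' > k \<and> g k' = y}) =
    color_pairs x y (\<lambda>k. g (Suc k)) n"
proof -
  have "(\<Sum>k\<in>{k\<in>{1..n}. g k = x}. card {k'\<in>{1..n}. k' > k \<and> g k' = y}) =
      (\<Sum>k=1..n. \<Sum>k'=1..n. of_bool (g k' = y) * of_bool (k < k' \<and> g k = x))"
    unfolding sum_card_filter_eq[OF finite_atLeastAtMost] sum_distrib_left
    by (intro sum.cong refl) simp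
  also have "\<dots> = (\<Sum>k'=1..n. of_bool (g k' = y) * (\<Sum>k=1..n. of_bool (k < k' \<and> g k = x)))"
    unfolding sum_distrib_left by (rule sum.swap)
  also have "\<dots> = color_pairs x y (\<lambda>k. g (Suc k)) n"
    unfolding color_pairs_def One_nat_def sum.atLeast1_atMost_eq
    by (intro sum.cong arg_cong2[where f="(*)"] refl sum.mono_neutral_cong_right) auto
  finally show ?thesis .
qed

lemma color_pairs_eq_card_less:
  "(\<Sum>k\<in>{k\<in>{1..n}. g k = x}. card {k'\<in>{1..n}. k' < k \<and> g k' = y}) =
    color_pairs y x (\<lambda>k. g (Suc k)) n"
proof -
  have "(\<Sum>k\<in>{k\<in>{1..n}. g k = x}. card {k'\<in>{1..n}. k' < k \<and> g k' = y}) =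
      (\<Sum>k=1..n. of_bool (g k = x) * (\<Sum>k'=1..n. of_bool (k' < k \<and> g k' = y)))"
    by (rule sum_card_filter_eq) simp
  also have "\<dots> = color_pairs y x (\<lambda>k. g (Suc k)) n"
    unfolding color_pairs_def One_nat_def sum.atLeast1_atMost_eq
    by (intro sum.cong arg_cong2[where f="(*)"] refl sum.mono_neutral_cong_right) auto
  finally show ?thesis .
qed

lemma flux_swap: "flux v u = - flux u v"
  by (simp add: flux_def algebra_simps)

text \<open>Only an edge of color 1 moves \<open>Q\<close>, and it leaves \<open>P\<close> fixed, so
  it contributes \<open>2 * cnj P * u\<close>, where \<open>P\<close> is \<open>a\<close> plus
  \<open>u\<close> times the number of earlier edges of color 0. As \<open>cnj u * u = 1\<close>,
  the second summand counts pairs.\<close>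

lemma flux_side:
  assumes "\<And>k. k < n \<Longrightarrow> f k \<in> {Col0, Col1}" and "cnj u * u = 1"
  shows "(\<Sum>k<n. flux (a + u * (\<Sum>j<k. weight0 (f j)), b + u * (\<Sum>j<k. weight1 (f j)))
        (a + u * (\<Sum>j<Suc k. weight0 (f j)), b + u * (\<Sum>j<Suc k. weight1 (f j)))) =
    2 * cnj a * u * (\<Sum>k<n. of_bool (f k = Col1)) + 2 * of_nat (color_pairs Col0 Col1 f n)"
  using assms(1)
proof (induction n)
  case 0
  show ?case by (simp add: color_pairs_def)
next
  case (Suc n)
  have w: "weight0 (f j) = of_bool (f j = Col0)" if "j < Suc n" for j
    using Suc.prems[OF that] by auto
  have "f n \<in> {Col0, Col1}"
    using Suc.prems by simp
  moreover have "(\<Sum>j<n. weight0 (f j)) = of_nat (\<Sum>j<n. of_bool (f j = Col0))"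
    by (simp add: w)
  moreover have "cnj u * (u * z) = z" for z
    using assms(2) by (simp flip: mult.assoc)
  ultimately have "flux (a + u * (\<Sum>j<n. weight0 (f j)), b + u * (\<Sum>j<n. weight1 (f j)))
        (a + u * (\<Sum>j<Suc n. weight0 (f j)), b + u * (\<Sum>j<Suc n. weight1 (f j))) =
      2 * cnj a * u * of_bool (f n = Col1) +
      2 * of_nat (of_bool (f n = Col1) * (\<Sum>j<n. of_bool (f j = Col0)))"
    by (auto simp: flux_def algebra_simps simp del: of_nat_sum)
  with Suc show ?case
    by (simp add: color_pairs_def algebra_simps)
qed

section \<open>The area identity on a colored triangle in integer coordinates\<close>

lemma area_eq: "area x = - xi\<^sup>2 * of_bool (x = Col3) + (cnj xi)\<^sup>2 * of_bool (x = ColM)"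
  by (cases x) auto

text \<open>\<open>H r s\<close>, \<open>L r s\<close>, \<open>D r s\<close> are the colors of the bottom, left and right edge of the upward triangle
  with lower left corner \<open>r + s \<xi>\<close>. Both kinds of face list their edges clockwise as \<open>L\<close>, \<open>D\<close>, \<open>H\<close>.\<close>

locale triangle_coloring =
  fixes n :: nat and H L D :: "nat \<Rightarrow> nat \<Rightarrow> color"
  assumes up: "r + s < n \<Longrightarrow> face_colors (L r s) (D r s) (H r s)"
    and down: "Suc (r + s) < n \<Longrightarrow> face_colors (L (Suc r) s) (D r s) (H r (Suc s))"
begin

text \<open>The deformed vertex is reached by walking up the left side and then east along row
  \<open>s\<close>. The closing condition makes the steps in the other two directions consistent
  with this choice of path.\<close>

definition position :: "(color \<Rightarrow> complex) \<Rightarrow> nat \<Rightarrow> nat \<Rightarrow> complex" where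
  "position w r s = xi * (\<Sum>j<s. w (L 0 j)) + (\<Sum>i<r. w (H i s))"

lemma position_east: "position w (Suc r) s = position w r s + w (H r s)"
  by (simp add: position_def)

text \<open>Induction along the row: the upward face at \<open>(r, s)\<close> and the downward face
  to its right share the edge \<open>D r s\<close>, and subtracting their closing conditions
  eliminates it.\<close>

lemma position_north:
  assumes "\<And>x y z. face_colors x y z \<Longrightarrow> xi * w x + cnj xi * w y = w z" and "r + s < n"
  shows "position w r (Suc s) = position w r s + xi * w (L r s)"
  using assms(2)
proof (induction r)
  case 0
  show ?case by (simp add: position_def algebra_simps)
next
  case (Suc r)
  then have "xi * w (L r s) + cnj xi * w (D r s) = w (H r s)"
    and "xi * w (L (Suc r) s) + cnj xi * w (D r s) = w (H r (Suc s))"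
    using assms(1) up[of r s] down[of r s] by auto
  then have "w (H r (Suc s)) - xi * w (L (Suc r) s) = w (H r s) - xi * w (L r s)"
    by (metis add_diff_cancel_left')
  then show ?case
    using Suc by (simp add: position_east algebra_simps)
qed

lemma position_diagonal:
  assumes "\<And>x y z. face_colors x y z \<Longrightarrow> xi * w x + cnj xi * w y = w z" and "r + s < n"
  shows "position w (Suc r) s = position w r (Suc s) + cnj xi * w (D r s)"
  using position_north[OF assms] assms(1)[OF up[OF assms(2)]]
  by (simp add: position_east algebra_simps)

definition vertex :: "nat \<Rightarrow> nat \<Rightarrow> complex \<times> complex" where
  "vertex r s = (position weight0 r s, position weight1 r s)"

lemma flux_up:
  assumes "r + s < n"
  shows "flux (vertex r s) (vertex r (Suc s)) + flux (vertex r (Suc s)) (vertex (Suc r) s) +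
      flux (vertex (Suc r) s) (vertex r s) = area (L r s) + area (D r s) + area (H r s)"
  using area_face(1)[OF up[OF assms]]
    position_north[OF weight0_closed assms] position_north[OF weight1_closed assms]
    position_diagonal[OF weight0_closed assms] position_diagonal[OF weight1_closed assms]
  by (simp add: vertex_def flux_triangle)

text \<open>Each edge is traversed in the same direction as in its upward face, which reverses the
  orientation of the downward face; hence the minus sign.\<close>

lemma flux_down:
  assumes "Suc (r + s) < n"
  shows "flux (vertex (Suc r) s) (vertex (Suc r) (Suc s)) + flux (vertex r (Suc s)) (vertex (Suc r) s) +
      flux (vertex (Suc r) (Suc s)) (vertex r (Suc s)) =
      - (area (L (Suc r) s) + area (D r s) + area (H r (Suc s)))"
proof -
  have lt: "Suc r + s < n"
    using assms by simp
  have east: "position w r (Suc s) = position w (Suc r) (Suc s) - w (H r (Suc s))" for w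
    by (simp add: position_east)
  have "flux (vertex (Suc r) s) (vertex (Suc r) (Suc s)) +
      flux (vertex (Suc r) (Suc s)) (vertex r (Suc s)) + flux (vertex r (Suc s)) (vertex (Suc r) s) =
      - (area (L (Suc r) s) + area (D r s) + area (H r (Suc s)))"
    unfolding area_face(2)[OF down[OF assms], symmetric] vertex_def flux_triangle
    by (simp add: east position_north[OF weight0_closed lt] position_north[OF weight1_closed lt])
  then show ?thesis
    by (simp add: add_ac)
qed

text \<open>This presents the right side as a walk from the top corner in direction
  \<open>cnj xi\<close>, the shape that \<open>flux_side\<close> expects.\<close>

lemma position_right:
  assumes "\<And>x y z. face_colors x y z \<Longrightarrow> xi * w x + cnj xi * w y = w z" and "r \<le> n"
  shows "position w r (n - r) =
    xi * (\<Sum>j<n. w (L 0 j)) + cnj xi * (\<Sum>j<r. w (D j (n - 1 - j)))"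
  using assms(2)
proof (induction r)
  case 0
  show ?case by (simp add: position_def)
next
  case (Suc r)
  then have "n - r = Suc (n - Suc r)" and "r + (n - Suc r) < n"
    by auto
  then show ?case
    using Suc position_diagonal[where w=w and r=r and s="n - Suc r"] assms(1)
    by (simp add: algebra_simps)
qed

definition edge_count :: "color \<Rightarrow> nat" where
  "edge_count x =
    triangle_sum n (\<lambda>r s. of_bool (L r s = x) + of_bool (D r s = x) + of_bool (H r s = x))"

lemma triangle_sum_area:
  "triangle_sum n (\<lambda>r s. area (L r s) + area (D r s) + area (H r s)) =
    - xi\<^sup>2 * of_nat (edge_count Col3) + (cnj xi)\<^sup>2 * of_nat (edge_count ColM)"
  by (simp add: edge_count_def triangle_sum_def area_eq sum_distrib_left algebra_simps
      flip: sum.distrib sum_subtractf sum_negf del: sum_of_bool_eq)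

text \<open>Green's formula is used twice. For \<open>area\<close> the boundary terms vanish, as the
  colors 0 and 1 carry no area, so upward and downward faces have equal totals. For the flux the
  downward total enters negated, so the boundary flux is twice the upward total.\<close>

lemma area_eq_boundary_flux:
  assumes "n > 0"
    and left: "\<And>k. k < n \<Longrightarrow> L 0 k \<in> {Col0, Col1}"
    and right: "\<And>k. k < n \<Longrightarrow> D k (n - 1 - k) \<in> {Col0, Col1}"
    and bottom: "\<And>k. k < n \<Longrightarrow> H k 0 \<in> {Col0, Col1}"
  shows "2 * triangle_sum n (\<lambda>r s. area (L r s) + area (D r s) + area (H r s)) =
      (\<Sum>s<n. flux (vertex 0 s) (vertex 0 (Suc s))) +
      (\<Sum>r<n. flux (vertex r (n - r)) (vertex (Suc r) (n - Suc r))) -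
      (\<Sum>r<n. flux (vertex r 0) (vertex (Suc r) 0))"
proof -
  let ?up = "triangle_sum n (\<lambda>r s. area (L r s) + area (D r s) + area (H r s))"
  let ?down = "triangle_sum (n - 1) (\<lambda>r s. area (L (Suc r) s) + area (D r s) + area (H r (Suc s)))"
  have "area (L 0 k) = 0" "area (D k (n - 1 - k)) = 0" "area (H k 0) = 0" if "k < n" for k
    using left[OF that] right[OF that] bottom[OF that] by auto
  then have area: "?up = ?down"
    by (subst triangle_green[OF \<open>n > 0\<close>]) simp
  have "?up = triangle_sum n (\<lambda>r s. flux (vertex r s) (vertex r (Suc s)) +
      flux (vertex r (Suc s)) (vertex (Suc r) s) + flux (vertex (Suc r) s) (vertex r s))"
    by (intro triangle_sum_cong flux_up[symmetric])
  also have "\<dots> = triangle_sum (n - 1) (\<lambda>r s.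
        flux (vertex (Suc r) s) (vertex (Suc r) (Suc s)) + flux (vertex r (Suc s)) (vertex (Suc r) s) +
        flux (vertex (Suc r) (Suc s)) (vertex r (Suc s))) +
      ((\<Sum>s<n. flux (vertex 0 s) (vertex 0 (Suc s))) +
      (\<Sum>r<n. flux (vertex r (Suc (n - 1 - r))) (vertex (Suc r) (n - 1 - r))) +
      (\<Sum>r<n. flux (vertex (Suc r) 0) (vertex r 0)))"
    by (rule triangle_green[OF \<open>n > 0\<close>])
  also have "triangle_sum (n - 1) (\<lambda>r s.
        flux (vertex (Suc r) s) (vertex (Suc r) (Suc s)) + flux (vertex r (Suc s)) (vertex (Suc r) s) +
        flux (vertex (Suc r) (Suc s)) (vertex r (Suc s))) =
      triangle_sum (n - 1) (\<lambda>r s. - (area (L (Suc r) s) + area (D r s) + area (H r (Suc s))))"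
    by (intro triangle_sum_cong flux_down) simp
  also have "\<dots> = - ?down"
    by (simp add: triangle_sum_def sum_negf flip: sum_negf)
  also have "(\<Sum>r<n. flux (vertex (Suc r) 0) (vertex r 0)) =
      - (\<Sum>r<n. flux (vertex r 0) (vertex (Suc r) 0))"
    unfolding sum_negf[symmetric] by (intro sum.cong refl flux_swap)
  also have "(\<Sum>r<n. flux (vertex r (Suc (n - 1 - r))) (vertex (Suc r) (n - 1 - r))) =
      (\<Sum>r<n. flux (vertex r (n - r)) (vertex (Suc r) (n - Suc r)))"
    by (intro sum.cong refl) (simp add: Suc_diff_Suc)
  finally show ?thesis
    using area by simp
qed

lemma edge_count_eq:
  assumes "n > 0"
    and left: "\<And>k. k < n \<Longrightarrow> L 0 k \<in> {Col0, Col1}"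
    and right: "\<And>k. k < n \<Longrightarrow> D k (n - 1 - k) \<in> {Col0, Col1}"
    and bottom: "\<And>k. k < n \<Longrightarrow> H k 0 \<in> {Col0, Col1}"
    and n0: "(\<Sum>k<n. of_bool (L 0 k = Col0)) = n0"
    and n1: "(\<Sum>k<n. of_bool (D k (n - 1 - k) = Col1)) = n1"
  shows "edge_count Col3 + edge_count ColM = n0 * n1"
    and "int (edge_count Col3) - int (edge_count ColM) =
      2 * (int (color_pairs Col0 Col1 (L 0) n) +
        int (color_pairs Col0 Col1 (\<lambda>k. D k (n - 1 - k)) n) -
        int (color_pairs Col0 Col1 (\<lambda>k. H k 0) n)) - int n0 * int n1"
proof -
  let ?l = "color_pairs Col0 Col1 (L 0) n"
  let ?d = "color_pairs Col0 Col1 (\<lambda>k. D k (n - 1 - k)) n"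
  let ?h = "color_pairs Col0 Col1 (\<lambda>k. H k 0) n"
  let ?s = "edge_count Col3" and ?m = "edge_count ColM"
  have unit: "cnj xi * xi = 1"
    by (simp add: cnj_xi xi_mult_xi algebra_simps)
  \<comment> \<open>The left and bottom sides start at the origin, so \<open>a = 0\<close> and only
    the pair counts remain.\<close>
  have l: "(\<Sum>s<n. flux (vertex 0 s) (vertex 0 (Suc s))) = 2 * of_nat ?l"
    using flux_side[where f="L 0" and a=0 and b=0, OF left unit]
    by (simp add: vertex_def position_def)
  have h: "(\<Sum>r<n. flux (vertex r 0) (vertex (Suc r) 0)) = 2 * of_nat ?h"
    using flux_side[where f="\<lambda>k. H k 0" and a=0 and b=0 and u=1, OF bottom]
    by (simp add: vertex_def position_def)
  have weight: "(\<Sum>k<n. weight0 (L 0 k)) = of_nat n0"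
  proof -
    have "weight0 (L 0 k) = of_nat (of_bool (L 0 k = Col0))" if "k < n" for k
      using left[OF that] by auto
    then show ?thesis
      by (simp flip: n0)
  qed
  \<comment> \<open>The right side starts at the top corner, where \<open>P\<close> is
    \<open>xi * n0\<close>; this offset, met by its \<open>n1\<close> edges of color 1, produces the
    \<open>n0 * n1\<close> term.\<close>
  have "(\<Sum>r<n. flux (vertex r (n - r)) (vertex (Suc r) (n - Suc r))) =
      2 * cnj (xi * (\<Sum>k<n. weight0 (L 0 k))) * cnj xi * of_nat n1 + 2 * of_nat ?d"
    using flux_side[where f="\<lambda>k. D k (n - 1 - k)" and u="cnj xi" and n=n
        and a="xi * (\<Sum>k<n. weight0 (L 0 k))" and b="xi * (\<Sum>k<n. weight1 (L 0 k))", OF right]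
    by (simp add: vertex_def position_right[OF weight0_closed] position_right[OF weight1_closed]
        unit[unfolded mult.commute[of "cnj xi"]] Suc_leI flip: n1 del: sum.lessThan_Suc)
  then have d: "(\<Sum>r<n. flux (vertex r (n - r)) (vertex (Suc r) (n - Suc r))) =
      2 * (cnj xi)\<^sup>2 * of_nat (n0 * n1) + 2 * of_nat ?d"
    by (simp add: weight power2_eq_square mult_ac)
  have "2 * (- xi\<^sup>2 * of_nat ?s + (cnj xi)\<^sup>2 * of_nat ?m) =
      2 * of_nat ?l + (2 * (cnj xi)\<^sup>2 * of_nat (n0 * n1) + 2 * of_nat ?d) - 2 * of_nat ?h"
    using area_eq_boundary_flux[OF assms(1-4)] unfolding triangle_sum_area l h d .
  also have "\<dots> = 2 * (of_nat ?l + (cnj xi)\<^sup>2 * of_nat (n0 * n1) + of_nat ?d - of_nat ?h)"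
    by (simp add: algebra_simps)
  finally have "- xi\<^sup>2 * of_nat ?s + (cnj xi)\<^sup>2 * of_nat ?m =
      of_nat ?l + (cnj xi)\<^sup>2 * of_nat (n0 * n1) + of_nat ?d - of_nat ?h"
    by (simp only: mult_cancel_left) simp
  \<comment> \<open>Both sides are expressed in the basis 1, \<open>xi\<close>, so that real and
    imaginary parts can be compared.\<close>
  moreover have "(cnj xi)\<^sup>2 = - xi" "xi\<^sup>2 = xi - 1"
    by (simp_all add: cnj_xi power2_eq_square xi_mult_xi algebra_simps)
  ultimately have "of_nat ?s * (1 - xi) - of_nat ?m * xi =
      of_nat ?l - of_nat (n0 * n1) * xi + of_nat ?d - of_nat ?h"
    by (simp add: algebra_simps)
  then have "real ?s / 2 - real ?m / 2 = real ?l - real (n0 * n1) / 2 + real ?d - real ?h"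
    and "(real ?s + real ?m) * (sqrt 3 / 2) = real (n0 * n1) * (sqrt 3 / 2)"
    by (auto simp: complex_eq_iff algebra_simps)
  then have re: "real ?s - real ?m = 2 * (real ?l + real ?d - real ?h) - real (n0 * n1)"
    and im: "real ?s + real ?m = real (n0 * n1)"
    by (simp_all only: mult_cancel_right) auto
  show "?s + ?m = n0 * n1"
    using im by linarith
  have "real_of_int (int ?s - int ?m) =
      real_of_int (2 * (int ?l + int ?d - int ?h) - int n0 * int n1)"
    using re by simp
  then show "int ?s - int ?m = 2 * (int ?l + int ?d - int ?h) - int n0 * int n1"
    by (simp only: of_int_eq_iff)
qed

end

section \<open>Edges and faces of the complex lattice in integer coordinates\<close>

definition lattice_point :: "nat \<Rightarrow> nat \<Rightarrow> complex" where
  "lattice_point r s = of_nat r + of_nat s * xi"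

lemma lattice_point_eq_iff [simp]:
  "lattice_point r s = lattice_point r' s' \<longleftrightarrow> r = r' \<and> s = s'"
  by (auto simp: lattice_point_def complex_eq_iff)

lemma lattice_point_add:
  "lattice_point r s + 1 = lattice_point (Suc r) s"
  "lattice_point r s + xi = lattice_point r (Suc s)"
  "lattice_point r (Suc s) + cnj xi = lattice_point (Suc r) s"
  by (simp_all add: lattice_point_def cnj_xi algebra_simps)

lemma lattice_points_eq: "lattice_points n = {lattice_point r s | r s. r + s \<le> n}"
  by (simp add: lattice_points_def lattice_point_def)

definition horizontal :: "nat \<Rightarrow> nat \<Rightarrow> complex set" where
  "horizontal r s = closed_segment (lattice_point r s) (lattice_point (Suc r) s)"

definition rising :: "nat \<Rightarrow> nat \<Rightarrow> complex set" where
  "rising r s = closed_segment (lattice_point r s) (lattice_point r (Suc s))"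

definition falling :: "nat \<Rightarrow> nat \<Rightarrow> complex set" where
  "falling r s = closed_segment (lattice_point r (Suc s)) (lattice_point (Suc r) s)"

lemmas edge_defs = horizontal_def rising_def falling_def

lemma lattice_edges_eq:
  "lattice_edges n = case_prod rising ` {(r, s). r + s < n} \<union>
    case_prod falling ` {(r, s). r + s < n} \<union> case_prod horizontal ` {(r, s). r + s < n}"
    (is "_ = ?R")
proof
  show "lattice_edges n \<subseteq> ?R"
  proof
    fix e assume "e \<in> lattice_edges n"
    then obtain r s r' s' w where e: "e = closed_segment (lattice_point r s) (lattice_point r s + w)"
      and w: "lattice_point r s + w = lattice_point r' s'" "w \<in> {1, xi, cnj xi}"
      and le: "r + s \<le> n" "r' + s' \<le> n"
      by (auto simp: lattice_edges_def lattice_points_eq)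
    consider "w = 1" | "w = xi" | "w = cnj xi"
      using w(2) by auto
    then show "e \<in> ?R"
    proof cases
      case 1
      then have "e = horizontal r s" "r + s < n"
        using e w(1) le by (auto simp: lattice_point_add edge_defs)
      then show ?thesis by auto
    next
      case 2
      then have "e = rising r s" "r + s < n"
        using e w(1) le by (auto simp: lattice_point_add edge_defs)
      then show ?thesis by auto
    next
      case 3
      \<comment> \<open>Since \<open>cnj xi = 1 - xi\<close>, moving \<open>xi\<close> to the other
        side leaves lattice points on both sides; this also excludes \<open>s = 0\<close>.\<close>
      have "s = Suc s'" "r' = Suc r"
      proof -
        have "lattice_point r' (Suc s') = lattice_point (Suc r) s"
          using w(1) by (simp add: 3 lattice_point_def cnj_xi algebra_simps)
        then show "s = Suc s'" "r' = Suc r" by auto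
      qed
      then have "e = falling r s'" "r + s' < n"
        using e w(1) le by (auto simp: edge_defs)
      then show ?thesis by auto
    qed
  qed
  have "closed_segment z (z + w) \<in> lattice_edges n"
    if "z = lattice_point r s" "z + w = lattice_point r' s'" "r + s \<le> n" "r' + s' \<le> n"
      "w \<in> {1, xi, cnj xi}" for z w r s r' s'
    unfolding lattice_edges_def lattice_points_eq using that by blast
  from this[OF refl lattice_point_add(1)] this[OF refl lattice_point_add(2)]
    this[OF refl lattice_point_add(3)]
  show "?R \<subseteq> lattice_edges n"
    by (auto simp: lattice_point_add edge_defs)
qed

text \<open>A segment determines its endpoints, hence its direction and its indices, so no edge is
  counted twice.\<close>

lemma color_count_eq:
  "color_count n C x = triangle_sum n (\<lambda>r s. of_bool (C (rising r s) = x) +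
    of_bool (C (falling r s) = x) + of_bool (C (horizontal r s) = x))"
proof -
  let ?D = "{(r, s). r + s < n}"
  let ?f = "\<lambda>e. of_bool (C e = x) :: nat"
  have fin: "finite ?D"
    by (rule finite_subset[of _ "{..n} \<times> {..n}"]) auto
  have inj: "inj_on (case_prod rising) ?D" "inj_on (case_prod falling) ?D"
    "inj_on (case_prod horizontal) ?D"
    by (auto simp: inj_on_def edge_defs doubleton_eq_iff)
  have disj: "case_prod rising ` ?D \<inter> case_prod falling ` ?D = {}"
    "(case_prod rising ` ?D \<union> case_prod falling ` ?D) \<inter> case_prod horizontal ` ?D = {}"
    by (auto simp: edge_defs doubleton_eq_iff)
  have "color_count n C x = sum ?f (lattice_edges n)"
    unfolding color_count_def by (rule card_filter_eq_sum[OF finite_lattice_edges])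
  also have "\<dots> = sum ?f (case_prod rising ` ?D) + sum ?f (case_prod falling ` ?D) +
      sum ?f (case_prod horizontal ` ?D)"
    unfolding lattice_edges_eq
    by (simp add: sum.union_disjoint disj fin del: sum_of_bool_eq)
  also have "\<dots> = triangle_sum n (\<lambda>r s. of_bool (C (rising r s) = x) +
      of_bool (C (falling r s) = x) + of_bool (C (horizontal r s) = x))"
    unfolding inj[THEN sum.reindex] triangle_sum_eq
    by (simp add: sum.distrib case_prod_unfold comp_def)
  finally show ?thesis .
qed

lemma lattice_point_Suc:
  "lattice_point (Suc r) s = lattice_point r s + 1"
  "lattice_point r (Suc s) = lattice_point r s + xi"
  by (simp_all add: lattice_point_add)

lemma norm_one_minus_xi [simp]: "norm (1 - xi) = 1"
  by (simp flip: cnj_xi)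

lemma norm_xi_minus_one [simp]: "norm (xi - 1) = 1"
  by (subst norm_minus_commute) simp

lemma lattice_point_in_lattice_points: "r + s \<le> n \<Longrightarrow> lattice_point r s \<in> lattice_points n"
  by (auto simp: lattice_points_eq)

lemma clockwise_face_up:
  assumes "r + s < n"
  shows "clockwise_face n (lattice_point r s) (lattice_point r (Suc s)) (lattice_point (Suc r) s)"
proof -
  have "{lattice_point r s, lattice_point r (Suc s), lattice_point (Suc r) s} \<subseteq> lattice_points n"
    using assms by (simp add: lattice_point_in_lattice_points)
  then show ?thesis
    by (simp add: clockwise_face_def dist_norm lattice_point_Suc)
qed

lemma clockwise_face_down:
  assumes "Suc (r + s) < n"
  shows "clockwise_face n (lattice_point r (Suc s)) (lattice_point (Suc r) (Suc s))
    (lattice_point (Suc r) s)"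
proof -
  have "{lattice_point r (Suc s), lattice_point (Suc r) (Suc s), lattice_point (Suc r) s} \<subseteq>
      lattice_points n"
    using assms by (simp add: lattice_point_in_lattice_points)
  then show ?thesis
    by (simp add: clockwise_face_def dist_norm lattice_point_Suc)
qed

lemma face_colors_rotate: "face_colors x y z \<Longrightarrow> face_colors y z x"
  by (auto simp: face_colors_def)

lemma face_colors_if_clockwise_face:
  assumes "color_map n C" and "clockwise_face n a b c"
  shows "face_colors (C (closed_segment a b)) (C (closed_segment b c)) (C (closed_segment c a))"
  using assms face_colors_if_rotate unfolding color_map_def by blast

lemma triangle_coloring_if_color_map:
  assumes "color_map n C"
  shows "triangle_coloring n (\<lambda>r s. C (horizontal r s)) (\<lambda>r s. C (rising r s)) (\<lambda>r s. C (falling r s))"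
proof
  fix r s :: nat
  show "face_colors (C (rising r s)) (C (falling r s)) (C (horizontal r s))" if "r + s < n"
    using face_colors_if_clockwise_face[OF assms clockwise_face_up[OF that]]
    by (simp add: edge_defs closed_segment_commute)
  \<comment> \<open>The clockwise listing of the downward face starts with its horizontal edge; one
    rotation moves that edge to the end.\<close>
  show "face_colors (C (rising (Suc r) s)) (C (falling r s)) (C (horizontal r (Suc s)))"
    if "Suc (r + s) < n"
    using face_colors_rotate[OF face_colors_if_clockwise_face[OF assms clockwise_face_down[OF that]]]
    by (simp add: edge_defs closed_segment_commute)
qed

section \<open>Boundary sides and the final count\<close>

lemma bottom_edge_Suc: "bottom_edge (Suc k) = horizontal k 0"
  and left_edge_Suc: "left_edge (Suc k) = rising 0 k"
  by (simp_all add: bottom_edge_def left_edge_def edge_defs lattice_point_def)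

lemma right_edge_Suc: "k < n \<Longrightarrow> right_edge n (Suc k) = falling k (n - 1 - k)"
  by (simp add: right_edge_def edge_defs lattice_point_def of_nat_diff algebra_simps)

lemma side_count_eq: "side_count n C e x = (\<Sum>k<n. of_bool (C (e (Suc k)) = x))"
  unfolding side_count_def card_filter_eq_sum[OF finite_atLeastAtMost]
  by (simp only: One_nat_def sum.atLeast1_atMost_eq)

text \<open>The edges of colors \<open>x\<close> and \<open>y\<close> form disjoint sets of total
  size \<open>n\<close>, so they exhaust the side.\<close>

lemma side_colors:
  assumes "side_count n C e x + side_count n C e y = n" and "x \<noteq> y" and "k < n"
  shows "C (e (Suc k)) \<in> {x, y}"
proof -
  let ?S = "\<lambda>x. {k\<in>{1..n}. C (e k) = x}"
  have "card (?S x \<union> ?S y) = card {1..n}"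
    using assms(1,2) by (subst card_Un_disjoint) (auto simp: side_count_def)
  then have "?S x \<union> ?S y = {1..n}"
    by (intro card_subset_eq) auto
  moreover have "Suc k \<in> {1..n}"
    using assms(3) by simp
  ultimately show ?thesis
    by blast
qed

lemma color_pairs_cong:
  "(\<And>k. k < n \<Longrightarrow> f k = g k) \<Longrightarrow> color_pairs x y f n = color_pairs x y g n"
  by (simp add: color_pairs_def)

theorem theorem2p5:
  fixes n n0 n1 :: nat and C :: "complex set \<Rightarrow> color"
  assumes "n \<ge> 1" and "n0 + n1 = n"
    and "color_map n C"
    and "side_count n C bottom_edge Col0 = n0" and "side_count n C bottom_edge Col1 = n1"
    and "side_count n C (right_edge n) Col0 = n0" and "side_count n C (right_edge n) Col1 = n1"
    and "side_count n C left_edge Col0 = n0" and "side_count n C left_edge Col1 = n1"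
  shows "int (color_count n C ColM) =
           int (gash0 n C) + int (gash1 n C) + int (gash2 n C) - int n0 * int n1
       \<and> int (color_count n C Col3) =
           2 * int n0 * int n1 - int (gash0 n C) - int (gash1 n C) - int (gash2 n C)"
proof -
  interpret triangle_coloring n "\<lambda>r s. C (horizontal r s)" "\<lambda>r s. C (rising r s)"
    "\<lambda>r s. C (falling r s)"
    by (rule triangle_coloring_if_color_map[OF assms(3)])
  define b where "b k = C (horizontal k 0)" for k
  define d where "d k = C (falling k (n - 1 - k))" for k
  define l where "l k = C (rising 0 k)" for k
  note side_defs = b_def bottom_edge_Suc d_def right_edge_Suc l_def left_edge_Suc
  \<comment> \<open>In the numbering of the sides, a 0 precedes a 1 in the pairs of
    \<open>gash0\<close>, but a 1 precedes a 0 in those of \<open>gash1\<close> and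
    \<open>gash2\<close>.\<close>
  have gash: "gash0 n C = color_pairs Col0 Col1 b n" "gash1 n C = color_pairs Col1 Col0 d n"
    "gash2 n C = color_pairs Col1 Col0 l n"
    unfolding gash0_def gash1_def gash2_def color_pairs_eq_card_greater color_pairs_eq_card_less
    by (rule color_pairs_cong, simp add: side_defs)+
  have colors: "b k \<in> {Col0, Col1}" "d k \<in> {Col0, Col1}" "l k \<in> {Col0, Col1}" if "k < n" for k
    using side_colors[of n C bottom_edge Col0 Col1 k] side_colors[of n C "right_edge n" Col0 Col1 k]
      side_colors[of n C left_edge Col0 Col1 k] assms that
    by (simp_all add: side_defs)
  have counts: "(\<Sum>k<n. of_bool (d k = Col0)) = n0" "(\<Sum>k<n. of_bool (d k = Col1)) = n1"
    "(\<Sum>k<n. of_bool (l k = Col0)) = n0" "(\<Sum>k<n. of_bool (l k = Col1)) = n1"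
    using assms(6-9) unfolding side_count_eq
    by (simp_all add: side_defs cong: sum.cong_simp del: sum_of_bool_eq)
  have "edge_count x = color_count n C x" for x
    by (simp add: edge_count_def color_count_eq)
  moreover have "0 < n"
    using assms(1) by simp
  ultimately have "int (color_count n C Col3) + int (color_count n C ColM) = int n0 * int n1"
    and "int (color_count n C Col3) - int (color_count n C ColM) =
      2 * (int (color_pairs Col0 Col1 l n) + int (color_pairs Col0 Col1 d n) -
        int (color_pairs Col0 Col1 b n)) - int n0 * int n1"
    using edge_count_eq[of n0 n1, folded l_def b_def d_def, OF _ colors(3,2,1) counts(3,2)]
    by (simp_all flip: of_nat_add)
  \<comment> \<open>On the right and left sides the flux counts the complementary pairs. Exchanging
    them gives the difference of the two color counts as 3 \<open>n0 * n1\<close> minus twice the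
    sum of the gash numbers; with their sum \<open>n0 * n1\<close> this is a linear system for both
    counts.\<close>
  moreover have "int (color_pairs Col0 Col1 f n) + int (color_pairs Col1 Col0 f n) = int n0 * int n1"
    if "f = d \<or> f = l" for f
    using color_pairs_swap[of Col0 Col1 f n] counts that by (auto simp flip: of_nat_add)
  from this[of d] this[of l]
  have "int (color_pairs Col0 Col1 d n) + int (color_pairs Col1 Col0 d n) = int n0 * int n1"
    "int (color_pairs Col0 Col1 l n) + int (color_pairs Col1 Col0 l n) = int n0 * int n1"
    by simp_all
  ultimately show ?thesis
    unfolding gash by auto
qed

end
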